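(* Let $r>1$ be a fixed integer and, for each integer $s\ge 2$, let $H_{r,s}$ be the largest value obtained in $r$ rolls of a fair $s$-sided die. Then $$\lim_{s\to\infty}\frac{E[H_{r,s}]}{s}=\frac{r}{r+1}.$$
   Context: A fair $s$-sided die takes each value in $\{1,\dots,s\}$ with equal probability. An advantage experiment consists of rolling the die $r$ times (independently, so that all $s^r$ sequences in $\{1,\dots,s\}^r$ are equally likely) and taking the largest number rolled as the outcome. $H_{r,s}$ is the random variable giving this outcome, i.e. $H_{r,s}=\max(X_1,\dots,X_r)$ with $X_1,\dots,X_r$ independent and uniform on $\{1,\dots,s\}$. *)

theory Defs
  imports "HOL-Probability.Probability"
begin

text \<open>Meaningful only for \<open>s \<ge> 1\<close>: the uniform distribution on the empty set is unspecified.\<close>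

definition fair_die :: "nat \<Rightarrow> nat pmf" where
  "fair_die s = pmf_of_set {1..s}"

text \<open>An outcome of the experiment is a function \<open>\<omega>\<close> whose value \<open>\<omega> i\<close> is the
  result of roll \<open>i \<in> {1..r}\<close>; outside \<open>{1..r}\<close> it has the dummy value \<open>0\<close>.\<close>

definition rolls :: "nat \<Rightarrow> nat \<Rightarrow> (nat \<Rightarrow> nat) pmf" where
  "rolls r s = Pi_pmf {1..r} 0 (\<lambda>_. fair_die s)"

definition highest :: "nat \<Rightarrow> (nat \<Rightarrow> nat) \<Rightarrow> nat" where
  "highest r \<omega> = Max (\<omega> ` {1..r})"

lemma rolls_uniform:
  assumes "s \<ge> 1"
  shows "rolls r s = pmf_of_set (PiE_dflt {1..r} 0 (\<lambda>_. {1..s}))"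
  using assms unfolding rolls_def fair_die_def by (intro Pi_pmf_of_set) auto

end

theory Submission
  imports Defs
begin

text \<open>For an integer-valued \<open>H \<in> {0..s}\<close> the expectation is the sum of the tail
  probabilities \<open>P (H > k)\<close>, \<open>k < s\<close>, and here \<open>P (H > k) = 1 - (k/s) ^ r\<close>. Dividing by \<open>s\<close> leaves
  \<open>1\<close> minus a Riemann sum of \<open>x ^ r\<close> on the unit interval, which tends to \<open>1/(r+1)\<close>.\<close>

text \<open>The difference of powers factors as \<open>y - x\<close> times a sum of
  \<open>Suc n\<close> monomials of degree \<open>n\<close> in \<open>x\<close> and
  \<open>y\<close>; for \<open>0 \<le> x \<le> y\<close> each of them lies between
  \<open>x ^ n\<close> and \<open>y ^ n\<close>.\<close>

lemma power_Suc_diff_bounds: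
  fixes x y :: real
  assumes "0 \<le> x" "x \<le> y"
  shows "(y - x) * (real (Suc n) * x ^ n) \<le> y ^ Suc n - x ^ Suc n"
    and "y ^ Suc n - x ^ Suc n \<le> (y - x) * (real (Suc n) * y ^ n)"
proof -
  have "x ^ n \<le> x ^ (Suc n - Suc i) * y ^ i \<and> x ^ (Suc n - Suc i) * y ^ i \<le> y ^ n" if "i < Suc n" for i
  proof -
    have "x ^ (n - i) * x ^ i = x ^ n" "y ^ (n - i) * y ^ i = y ^ n"
      using that by (simp_all flip: power_add)
    moreover have "x ^ (n - i) * x ^ i \<le> x ^ (n - i) * y ^ i" "x ^ (n - i) * y ^ i \<le> y ^ (n - i) * y ^ i"
      using assms by (auto intro!: mult_left_mono mult_right_mono power_mono)
    ultimately show ?thesis by simp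
  qed
  then have "real (Suc n) * x ^ n \<le> (\<Sum>i<Suc n. x ^ (Suc n - Suc i) * y ^ i)"
      "(\<Sum>i<Suc n. x ^ (Suc n - Suc i) * y ^ i) \<le> real (Suc n) * y ^ n"
    using sum_bounded_below[of "{..<Suc n}" "x ^ n"] sum_bounded_above[of "{..<Suc n}" _ "y ^ n"]
    by (simp_all del: sum.lessThan_Suc)
  with assms show "(y - x) * (real (Suc n) * x ^ n) \<le> y ^ Suc n - x ^ Suc n"
      "y ^ Suc n - x ^ Suc n \<le> (y - x) * (real (Suc n) * y ^ n)"
    unfolding power_diff_sumr2[of y "Suc n" x]
    by (auto intro!: mult_left_mono simp del: sum.lessThan_Suc)
qed

text \<open>Left and right Riemann sums bracket the integral of a power, in discrete form: the
  increments of \<open>k ^ Suc r\<close> telescope to \<open>s ^ Suc r\<close>, and each is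
  estimated by the previous bounds with \<open>x = k\<close> and \<open>y = k + 1\<close>.\<close>

lemma sum_power_bounds:
  shows "real (Suc r) * (\<Sum>k<s. real k ^ r) \<le> real s ^ Suc r"
    and "real s ^ Suc r \<le> real (Suc r) * (\<Sum>k<s. real (Suc k) ^ r)"
proof -
  have telescope: "(\<Sum>k<s. real (Suc k) ^ Suc r - real k ^ Suc r) = real s ^ Suc r"
    by (subst sum_lessThan_telescope) simp
  show "real (Suc r) * (\<Sum>k<s. real k ^ r) \<le> real s ^ Suc r"
    unfolding telescope[symmetric] sum_distrib_left
    using power_Suc_diff_bounds(1)[of "real k" "real (Suc k)" r for k] by (intro sum_mono) simp
  show "real s ^ Suc r \<le> real (Suc r) * (\<Sum>k<s. real (Suc k) ^ r)"
    unfolding telescope[symmetric] sum_distrib_left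
    using power_Suc_diff_bounds(2)[of "real k" "real (Suc k)" r for k] by (intro sum_mono) simp
qed

text \<open>The left sum never exceeds the limit, and it falls short by at most its gap to the right
  sum, which is \<open>1 / s\<close> after normalization.\<close>

lemma sum_power_asymp:
  assumes "r > 0"
  shows "(\<lambda>s. (\<Sum>k<s. real k ^ r) / real s ^ Suc r) \<longlonglongrightarrow> 1 / (real r + 1)"
proof (rule tendsto_sandwich)
  have "(\<lambda>s. 1 / (real r + 1) - 1 / real s) \<longlonglongrightarrow> 1 / (real r + 1) - 0"
    by (intro tendsto_intros lim_1_over_n)
  then show "(\<lambda>s. 1 / (real r + 1) - 1 / real s) \<longlonglongrightarrow> 1 / (real r + 1)"
    by simp
  show "\<forall>\<^sub>F s in sequentially. 1 / (real r + 1) - 1 / real s \<le> (\<Sum>k<s. real k ^ r) / real s ^ Suc r"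
  proof (rule eventually_mono[OF eventually_gt_at_top[of 0]])
    fix s :: nat assume s: "s > 0"
    \<comment> \<open>Shifting the index adds the boundary term \<open>s ^ r\<close> and loses
      \<open>0 ^ r\<close>, which vanishes because \<open>r > 0\<close>.\<close>
    have "(\<Sum>k<s. real (Suc k) ^ r) = (\<Sum>k<s. real k ^ r) + real s ^ r"
      using assms sum.lessThan_Suc_shift[of "\<lambda>k. real k ^ r" s] by (simp add: zero_power)
    with sum_power_bounds(2)[of s r]
    have "real s ^ Suc r / (real r + 1) \<le> (\<Sum>k<s. real k ^ r) + real s ^ r"
      by (simp add: field_simps)
    then have "(real s ^ Suc r / (real r + 1) - real s ^ r) / real s ^ Suc r
        \<le> (\<Sum>k<s. real k ^ r) / real s ^ Suc r"
      by (intro divide_right_mono) auto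
    with s show "1 / (real r + 1) - 1 / real s \<le> (\<Sum>k<s. real k ^ r) / real s ^ Suc r"
      by (simp add: diff_divide_distrib)
  qed
  show "\<forall>\<^sub>F s in sequentially. (\<Sum>k<s. real k ^ r) / real s ^ Suc r \<le> 1 / (real r + 1)"
  proof (rule eventually_mono[OF eventually_gt_at_top[of 0]])
    fix s :: nat assume "s > 0"
    with sum_power_bounds(1)[of r s]
    show "(\<Sum>k<s. real k ^ r) / real s ^ Suc r \<le> 1 / (real r + 1)"
      by (simp add: divide_simps algebra_simps)
  qed
qed simp

lemma prob_fair_die_le:
  assumes "k \<le> s" "s > 0"
  shows "measure_pmf.prob (fair_die s) {..k} = real k / real s"
proof -
  have "{1..s} \<inter> {..k} = {1..k}" using assms by auto
  then show ?thesis
    using assms by (simp add: fair_die_def measure_pmf_of_set)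
qed

lemma prob_highest_le:
  assumes "k \<le> s" "s > 0" "r > 0"
  shows "measure_pmf.prob (rolls r s) {\<omega>. highest r \<omega> \<le> k} = (real k / real s) ^ r"
proof -
  \<comment> \<open>A maximum is at most \<open>k\<close> iff every roll is; \<open>r > 0\<close>
    keeps the set under \<open>Max\<close> nonempty. Independence then turns this product event into
    a product of \<open>r\<close> equal factors.\<close>
  have "{\<omega>. highest r \<omega> \<le> k} = Pi {1..r} (\<lambda>_. {..k})"
    using assms by (auto simp: highest_def)
  then show ?thesis
    using assms by (simp add: rolls_def measure_Pi_pmf_Pi prob_fair_die_le)
qed

text \<open>This allows the tail sum for the expectation to stop at \<open>s\<close>. The bound
  needs the support, since an arbitrary function may take larger values.\<close>

lemma highest_le:
  assumes "\<omega> \<in> set_pmf (rolls r s)" "s > 0" "r > 0"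
  shows "highest r \<omega> \<le> s"
proof -
  have "\<omega> \<in> PiE_dflt {1..r} 0 (\<lambda>_. {1..s})"
    using assms by (simp add: rolls_uniform finite_PiE_dflt PiE_dflt_empty_iff)
  with assms show ?thesis
    by (auto simp: highest_def PiE_dflt_def)
qed

lemma expectation_highest:
  assumes "s > 0" "r > 0"
  shows "measure_pmf.expectation (rolls r s) (\<lambda>\<omega>. real (highest r \<omega>))
    = (\<Sum>k<s. 1 - (real k / real s) ^ r)"
proof -
  have "measure_pmf.expectation (rolls r s) (\<lambda>\<omega>. real (highest r \<omega>))
      = measure_pmf.expectation (rolls r s) (\<lambda>\<omega>. \<Sum>k<s. indicator (- {\<omega>. highest r \<omega> \<le> k}) \<omega>)"
  proof (intro integral_cong_AE AE_pmfI)
    fix \<omega> assume "\<omega> \<in> set_pmf (rolls r s)"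
    then have "highest r \<omega> \<le> s"
      using assms highest_le by blast
    \<comment> \<open>Pointwise form of the tail sum: a natural number \<open>h \<le> s\<close>
      counts the \<open>k < s\<close> with \<open>k < h\<close>.\<close>
    then have "{..<s} \<inter> {k. k < highest r \<omega>} = {..<highest r \<omega>}"
      by auto
    then show "real (highest r \<omega>) = (\<Sum>k<s. indicator (- {\<omega>. highest r \<omega> \<le> k}) \<omega>)"
      by (simp add: indicator_def not_le sum.If_cases)
  qed simp_all
  also have "\<dots> = (\<Sum>k<s. measure_pmf.prob (rolls r s) (- {\<omega>. highest r \<omega> \<le> k}))"
    by (subst Bochner_Integration.integral_sum)
      (simp_all add: integrable_real_indicator measure_pmf.emeasure_finite less_top[symmetric])
  also have "\<dots> = (\<Sum>k<s. 1 - (real k / real s) ^ r)"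
    using assms by (intro sum.cong refl)
      (simp add: measure_pmf.prob_compl[of _ "rolls r s", simplified] Compl_eq_Diff_UNIV prob_highest_le)
  finally show ?thesis .
qed

theorem theorem3p1:
  fixes r :: nat
  assumes "r > 1"
  shows "(\<lambda>s::nat. measure_pmf.expectation (rolls r s) (\<lambda>\<omega>. real (highest r \<omega>)) / real s)
           \<longlonglongrightarrow> real r / (real r + 1)"
proof (rule Lim_transform_eventually)
  have "(\<lambda>s. 1 - (\<Sum>k<s. real k ^ r) / real s ^ Suc r) \<longlonglongrightarrow> 1 - 1 / (real r + 1)"
    using assms by (intro tendsto_diff tendsto_const sum_power_asymp) simp
  also have "1 - 1 / (real r + 1) = real r / (real r + 1)"
    by (simp add: field_simps)
  finally show "(\<lambda>s. 1 - (\<Sum>k<s. real k ^ r) / real s ^ Suc r) \<longlonglongrightarrow> real r / (real r + 1)" .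
  \<comment> \<open>The equality is claimed only eventually because \<open>s = 0\<close> gives no
    meaningful die. For \<open>s > 0\<close> the \<open>s\<close> constant terms of the tail sum
    contribute \<open>s / s = 1\<close>, and the factor \<open>1 / s\<close> raises the denominator
    \<open>s ^ r\<close> to \<open>s ^ Suc r\<close>.\<close>
  show "\<forall>\<^sub>F s in sequentially. 1 - (\<Sum>k<s. real k ^ r) / real s ^ Suc r
      = measure_pmf.expectation (rolls r s) (\<lambda>\<omega>. real (highest r \<omega>)) / real s"
  proof (rule eventually_mono[OF eventually_gt_at_top[of 0]])
    fix s :: nat assume s: "s > 0"
    have "(\<Sum>k<s. (real k / real s) ^ r) = (\<Sum>k<s. real k ^ r) / real s ^ r"
      by (simp add: power_divide sum_divide_distrib)
    with s assms show "1 - (\<Sum>k<s. real k ^ r) / real s ^ Suc r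
        = measure_pmf.expectation (rolls r s) (\<lambda>\<omega>. real (highest r \<omega>)) / real s"
      by (simp add: expectation_highest sum_subtractf diff_divide_distrib mult.commute)
  qed
qed

end
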